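(* The integrality gap of the linear program $(\mathrm{LP})$ $$\begin{aligned}\text{maximize}\quad & \sum_{t=1}^{nT}\sum_{j=1}^n v_j\, x_{j,t}\\ \text{s.t.}\quad & \sum_{t=1}^{nT}\frac{x_{j,t}}{p_j(t)}\le 1 && \forall j\in[n],\\ & \sum_{\tau\le t}\sum_{j=1}^n \overline F_{S_j}(t-\tau)\, x_{j,\tau}\le 1 && \forall t\in[nT],\\ & x_{j,t}\ge 0 && \forall j\in[n],\ t\in[nT]\end{aligned}$$ is at least $\left(1-\frac1e\right)$. Formally, there exists a family of instances of sequential selection with expirations (SSE) such that, as the instance size grows, the optimal value (the expected value of the optimal online policy) is at most $\left(1-\frac1e\right)$ times the optimal value of $(\mathrm{LP})$.
   Context: SSE problem. An instance consists of $n$ options. Option $j\in[n]=\{1,\dots,n\}$ has a deterministic value $v_j>0$, a random evaluation time $S_j$ and a random expiration time $E_j$, both taking positive integer values; all these $2n$ random variables are mutually independent, with known distributions and initially unknown realizations. Write $\overline F_{S_j}(t)=\Pr(S_j>t)$ and $p_j(t)=\Pr(E_j>t)$. It is assumed that there is $T\in\mathbb N$ with $\overline F_{S_j}(T)=0$ for all $j$, and that $p_j(t)>0$ for all $j\in[n]$ and all $t\ge1$. Time is discrete, $t=1,2,\dots$. Option $j$ is unexpired at time $t$ iff $E_j>t$; all options are available at time $1$. A decision-maker (DM) evaluates one option at a time and is free at time 1. If the DM is free at time $t$, it may select one option $j$ that is unexpired at time $t$ and has not been selected before; it is then busy for $S_j$ time units (free again at time $t+S_j$) and obtains value $v_j$.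 A selected option cannot be preempted and cannot expire. Meanwhile other options may expire. If the DM selects nothing at $t$, it is still free at $t+1$. An online policy decides, when the DM is free, which available option (if any) to select, using only the information revealed so far (past decisions, realized evaluation times of completed options, which options have expired). Its value is the expected sum of the values of the selected options; the optimal online policy is one of maximum value. The statement "as the instance size grows" is asymptotic: the bound on the ratio of the optimal value to the value of $(\mathrm{LP})$ holds in the limit along the family. *)

theory Defs
  imports "HOL-Probability.Probability"
begin

record sse_instance =
  num_opts :: nat                 (* n; the options are 1, ..., n *)
  val :: "nat \<Rightarrow> real"            (* v_j *)
  eval_dist :: "nat \<Rightarrow> nat pmf"   (* law of S_j *)
  expi_dist :: "nat \<Rightarrow> nat pmf"   (* law of E_j *)
  time_bound :: nat               (* T *)

definition options :: "sse_instance \<Rightarrow> nat set" where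
  "options I = {1..num_opts I}"

definition Fbar :: "sse_instance \<Rightarrow> nat \<Rightarrow> nat \<Rightarrow> real" where
  "Fbar I j t = measure_pmf.prob (eval_dist I j) {s. s > t}"

definition surv :: "sse_instance \<Rightarrow> nat \<Rightarrow> nat \<Rightarrow> real" where
  "surv I j t = measure_pmf.prob (expi_dist I j) {e. e > t}"

text \<open>The last condition says that every option is available at time 1: option j is unexpired
  at time t iff its expiration time exceeds t, so its expiration time is almost surely at least 2.\<close>

definition valid_instance :: "sse_instance \<Rightarrow> bool" where
  "valid_instance I \<longleftrightarrow>
     num_opts I \<ge> 1 \<and>
     (\<forall>j\<in>options I. val I j > 0) \<and>
     (\<forall>j\<in>options I. set_pmf (eval_dist I j) \<subseteq> {1..}) \<and>
     (\<forall>j\<in>options I. set_pmf (expi_dist I j) \<subseteq> {1..}) \<and>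
     (\<forall>j\<in>options I. Fbar I j (time_bound I) = 0) \<and>
     (\<forall>j\<in>options I. \<forall>t\<ge>1. surv I j t > 0) \<and>
     (\<forall>j\<in>options I. surv I j 1 = 1)"

text \<open>Joint law of (S, E): the 2n variables are mutually independent (coordinates outside
  the option set are constantly 0 and play no role).\<close>

definition scenarios :: "sse_instance \<Rightarrow> ((nat \<Rightarrow> nat) \<times> (nat \<Rightarrow> nat)) pmf" where
  "scenarios I = pair_pmf (Pi_pmf (options I) 0 (eval_dist I)) (Pi_pmf (options I) 0 (expi_dist I))"

text \<open>A history is the list of selections made so far, latest first, as pairs
  (option, time of selection).\<close>

type_synonym history = "(nat \<times> nat) list"

text \<open>What the decision-maker knows when free at time t: the time t, the selections made so far
  with their selection times and realized evaluation times, and, for the options that expired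
  without having been selected, their expiration times. Since selected options cannot expire,
  nothing is revealed about their expiration times beyond their being available when selected.\<close>

type_synonym info = "nat \<times> (nat \<times> nat \<times> nat) list \<times> (nat \<Rightarrow> nat option)"

definition info_at ::
    "sse_instance \<Rightarrow> (nat \<Rightarrow> nat) \<Rightarrow> (nat \<Rightarrow> nat) \<Rightarrow> history \<Rightarrow> nat \<Rightarrow> info" where
  "info_at I s e h t =
     (t,
      map (\<lambda>(j, u). (j, u, s j)) h,
      (\<lambda>j. if j \<in> options I \<and> j \<notin> fst ` set h \<and> e j \<le> t then Some (e j) else None))"

definition dm_free :: "(nat \<Rightarrow> nat) \<Rightarrow> history \<Rightarrow> nat \<Rightarrow> bool" where
  "dm_free s h t \<longleftrightarrow> (\<forall>(j, u)\<in>set h. u + s j \<le> t)"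

definition available :: "sse_instance \<Rightarrow> (nat \<Rightarrow> nat) \<Rightarrow> history \<Rightarrow> nat \<Rightarrow> nat \<Rightarrow> bool" where
  "available I e h t j \<longleftrightarrow> j \<in> options I \<and> e j > t \<and> j \<notin> fst ` set h"

text \<open>A policy maps the information at a time when the decision-maker is free to the option to
  select; None means that nothing is selected. Choosing an option that is not available has
  the same effect as selecting nothing.\<close>

type_synonym policy = "info \<Rightarrow> nat option"

text \<open>The value run I pol s e t is the history after the decisions at times 1, ..., t.\<close>

primrec run :: "sse_instance \<Rightarrow> policy \<Rightarrow> (nat \<Rightarrow> nat) \<Rightarrow> (nat \<Rightarrow> nat) \<Rightarrow> nat \<Rightarrow> history" where
  "run I pol s e 0 = []"
| "run I pol s e (Suc t) =
     (let h = run I pol s e t in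
      if dm_free s h (Suc t) then
        (case pol (info_at I s e h (Suc t)) of
           None \<Rightarrow> h
         | Some j \<Rightarrow> if available I e h (Suc t) j then (j, Suc t) # h else h)
      else h)"

definition selected :: "sse_instance \<Rightarrow> policy \<Rightarrow> (nat \<Rightarrow> nat) \<Rightarrow> (nat \<Rightarrow> nat) \<Rightarrow> nat set" where
  "selected I pol s e = (\<Union>t. fst ` set (run I pol s e t))"

definition policy_value :: "sse_instance \<Rightarrow> policy \<Rightarrow> real" where
  "policy_value I pol =
     measure_pmf.expectation (scenarios I) (\<lambda>(s, e). \<Sum>j\<in>selected I pol s e. val I j)"

text \<open>Policy values lie between 0 and the sum of all option values, and the feasible set of the
  linear program below is nonempty with bounded objective, so both suprema are genuine.\<close>

definition opt_value :: "sse_instance \<Rightarrow> real" where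
  "opt_value I = (SUP pol. policy_value I pol)"

definition lp_feasible :: "sse_instance \<Rightarrow> (nat \<Rightarrow> nat \<Rightarrow> real) \<Rightarrow> bool" where
  "lp_feasible I x \<longleftrightarrow>
     (let N = num_opts I * time_bound I in
      (\<forall>j\<in>options I. (\<Sum>t\<in>{1..N}. x j t / surv I j t) \<le> 1) \<and>
      (\<forall>t\<in>{1..N}. (\<Sum>\<tau>\<in>{1..t}. \<Sum>j\<in>options I. Fbar I j (t - \<tau>) * x j \<tau>) \<le> 1) \<and>
      (\<forall>j\<in>options I. \<forall>t\<in>{1..N}. x j t \<ge> 0))"

definition lp_objective :: "sse_instance \<Rightarrow> (nat \<Rightarrow> nat \<Rightarrow> real) \<Rightarrow> real" where
  "lp_objective I x =
     (\<Sum>t\<in>{1..num_opts I * time_bound I}. \<Sum>j\<in>options I. val I j * x j t)"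

definition lp_value :: "sse_instance \<Rightarrow> real" where
  "lp_value I = (SUP x\<in>{x. lp_feasible I x}. lp_objective I x)"

end

theory Submission
  imports Defs
begin

text \<open>Take \<open>m\<close> classes of \<open>m\<close> options of value 1. Options of class \<open>c\<close> have evaluation time
  \<open>2 ^ c\<close>, survive time 1 with probability \<open>1 / m\<close>, and if they do, hardly ever outlive time
  \<open>2 ^ c + 1\<close>. In expectation one option per class survives, and running class \<open>c\<close> during
  \<open>[2 ^ c + 1, 2 ^ (c + 1) + 1)\<close> fills the timeline exactly, so the linear program obtains \<open>m\<close>.
  A policy selects one option at time 1. A class \<open>c\<close> option selected later but not after time
  \<open>2 ^ c + 1\<close> blocks the decision-maker beyond that time, so every class contributes at most
  one of these, and none if no option of the class survives time 1. The surviving options of a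
  class are asymptotically Poisson with mean 1, whence \<open>m * (1 - 1 / e)\<close> up to a bounded error.\<close>

section \<open>Trajectories of an arbitrary policy\<close>

text \<open>\<open>selected\<close> forgets when an option was taken; the counting argument below
  compares selection times, so they are kept here.\<close>

definition selections ::
    "sse_instance \<Rightarrow> policy \<Rightarrow> (nat \<Rightarrow> nat) \<Rightarrow> (nat \<Rightarrow> nat) \<Rightarrow> (nat \<times> nat) set" where
  "selections I pol s e = (\<Union>t. set (run I pol s e t))"

lemma selected_eq_image: "selected I pol s e = fst ` selections I pol s e"
  unfolding selected_def selections_def by blast

text \<open>The inductions on \<open>run\<close> below go through this case split, so they never
  inspect the policy or the information it sees.\<close>

lemma run_Suc_cases:
  obtains "run I pol s e (Suc t) = run I pol s e t"
  | j where "run I pol s e (Suc t) = (j, Suc t) # run I pol s e t"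
      "dm_free s (run I pol s e t) (Suc t)" "available I e (run I pol s e t) (Suc t) j"
proof (cases "run I pol s e (Suc t) = run I pol s e t")
  case False
  define h where "h = run I pol s e t"
  from False obtain j where "dm_free s h (Suc t)" "pol (info_at I s e h (Suc t)) = Some j"
      "available I e h (Suc t) j"
    by (auto simp: Let_def h_def split: option.splits if_splits)
  then show ?thesis
    using that(2)[of j] by (simp add: h_def)
qed

lemma run_mono: "t \<le> t' \<Longrightarrow> set (run I pol s e t) \<subseteq> set (run I pol s e t')"
proof (induction t' rule: dec_induct)
  case (step t')
  then show ?case
    by (cases rule: run_Suc_cases[of I pol s e t']) auto
qed simp

lemma run_selection:
  assumes "(j, u) \<in> set (run I pol s e t)"
  shows "j \<in> options I" "1 \<le> u" "u \<le> t" "u < e j"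
proof -
  have "j \<in> options I \<and> 1 \<le> u \<and> u \<le> t \<and> u < e j"
    using assms
  proof (induction t)
    case (Suc t)
    show ?case
      using Suc by (cases rule: run_Suc_cases[of I pol s e t]) (auto simp: available_def)
  qed simp
  then show "j \<in> options I" "1 \<le> u" "u \<le> t" "u < e j"
    by auto
qed

text \<open>A selection added at \<open>Suc t\<close> is later than all earlier ones, whose times
  are at most \<open>t\<close>, and \<open>dm_free\<close> then says that each of those evaluations
  has ended.\<close>

lemma run_nonoverlapping:
  assumes "(j, u) \<in> set (run I pol s e t)" "(j', u') \<in> set (run I pol s e t)"
  shows "u < u' \<Longrightarrow> u + s j \<le> u'" "u = u' \<Longrightarrow> j = j'"
proof -
  have "(u < u' \<longrightarrow> u + s j \<le> u') \<and> (u = u' \<longrightarrow> j = j')"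
    using assms
  proof (induction t)
    case (Suc t)
    have le: "v \<le> t" if "(i, v) \<in> set (run I pol s e t)" for i v
      using run_selection(3)[OF that] .
    show ?case
    proof (cases rule: run_Suc_cases[of I pol s e t])
      case 1
      then show ?thesis using Suc by simp
    next
      case (2 i)
      then show ?thesis
        using Suc le[of j u] le[of j' u'] by (auto simp: dm_free_def)
    qed
  qed simp
  then show "u < u' \<Longrightarrow> u + s j \<le> u'" "u = u' \<Longrightarrow> j = j'"
    by auto
qed

lemma selections_selection:
  assumes "(j, u) \<in> selections I pol s e"
  shows "j \<in> options I" "1 \<le> u" "u < e j"
proof -
  obtain t where "(j, u) \<in> set (run I pol s e t)"
    using assms unfolding selections_def by blast
  from run_selection[OF this] show "j \<in> options I" "1 \<le> u" "u < e j"
    by auto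
qed

lemma selections_nonoverlapping:
  assumes "(j, u) \<in> selections I pol s e" "(j', u') \<in> selections I pol s e"
  shows "u < u' \<Longrightarrow> u + s j \<le> u'" "u = u' \<Longrightarrow> j = j'"
proof -
  obtain t t' where "(j, u) \<in> set (run I pol s e t)" "(j', u') \<in> set (run I pol s e t')"
    using assms unfolding selections_def by blast
  then have "(j, u) \<in> set (run I pol s e (max t t'))" "(j', u') \<in> set (run I pol s e (max t t'))"
    using run_mono[of t "max t t'" I pol s e] run_mono[of t' "max t t'" I pol s e] by auto
  from run_nonoverlapping[OF this]
  show "u < u' \<Longrightarrow> u + s j \<le> u'" "u = u' \<Longrightarrow> j = j'"
    by auto
qed

lemma finite_option_set: "finite (options I)"
  by (simp add: options_def)

lemma selected_subset: "selected I pol s e \<subseteq> options I"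
  unfolding selected_eq_image using selections_selection(1) by fastforce

section \<open>The gap instances and their survival probabilities\<close>

text \<open>Options are numbered from 1, hence the shift: class \<open>c\<close> is the block from
  \<open>c * m + 1\<close> to \<open>c * m + m\<close>.\<close>

definition opt_class :: "nat \<Rightarrow> nat \<Rightarrow> nat" where
  "opt_class m j = (j - 1) div m"

text \<open>The geometric tail, of total mass \<open>1 / m\<^sup>2\<close>, only serves to make all survival probabilities
  positive.\<close>

definition expiry :: "nat \<Rightarrow> nat \<Rightarrow> nat pmf" where
  "expiry m c = bind_pmf (bernoulli_pmf (1 / m))
     (\<lambda>b. if b then map_pmf ((+) (2 ^ c + 2)) (geometric_pmf (1 - 1 / m)) else return_pmf 2)"

text \<open>Evaluation times are deterministic, so all randomness lies in the expirations. Classes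
  are below \<open>m\<close>, so \<open>2 ^ m\<close> bounds every evaluation time.\<close>

definition gap_instance :: "nat \<Rightarrow> sse_instance" where
  "gap_instance m = \<lparr>num_opts = m * m, val = (\<lambda>_. 1),
     eval_dist = (\<lambda>j. return_pmf (2 ^ opt_class m j)),
     expi_dist = (\<lambda>j. expiry m (opt_class m j)), time_bound = 2 ^ m\<rparr>"

lemma gap_instance_simps [simp]:
  "num_opts (gap_instance m) = m * m" "val (gap_instance m) = (\<lambda>_. 1)"
  "eval_dist (gap_instance m) = (\<lambda>j. return_pmf (2 ^ opt_class m j))"
  "expi_dist (gap_instance m) = (\<lambda>j. expiry m (opt_class m j))"
  "time_bound (gap_instance m) = 2 ^ m"
  by (simp_all add: gap_instance_def)

lemma Fbar_gap_instance:
  "Fbar (gap_instance m) j t = (if t < 2 ^ opt_class m j then 1 else 0)"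
  by (simp add: Fbar_def)

lemma opt_class_less:
  assumes "j \<in> options (gap_instance m)"
  shows "opt_class m j < m"
proof -
  from assms have "j - 1 < m * m"
    by (auto simp: options_def)
  then show ?thesis
    unfolding opt_class_def by (simp add: less_mult_imp_div_less)
qed

lemma opt_class_fiber:
  assumes "c < m"
  shows "{j \<in> options (gap_instance m). opt_class m j = c} = {c * m + 1..<c * m + 1 + m}"
proof -
  have "Suc c * m \<le> m * m"
    using assms by (intro mult_le_mono1) auto
  then have "j \<le> m * m" if "j < c * m + 1 + m" for j
    using that by auto
  moreover have "(j - 1) div m = c \<longleftrightarrow> c * m \<le> j - 1 \<and> j - 1 < c * m + m" for j
  proof
    show "c * m \<le> j - 1 \<and> j - 1 < c * m + m" if "(j - 1) div m = c"
      using that assms div_times_less_eq_dividend[of "j - 1" m] dividend_less_div_times[of m "j - 1"]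
      by auto
    show "(j - 1) div m = c" if "c * m \<le> j - 1 \<and> j - 1 < c * m + m"
      using that by (intro div_nat_eqI) (auto simp: mult.commute)
  qed
  ultimately show ?thesis
    unfolding options_def opt_class_def by auto
qed

lemma prob_expiry:
  assumes "m \<ge> 2"
  shows "measure_pmf.prob (expiry m c) A =
    measure_pmf.prob (geometric_pmf (1 - 1 / m)) {g. 2 ^ c + 2 + g \<in> A} / m +
    (1 - 1 / m) * indicator A 2"
proof -
  have "emeasure (measure_pmf (expiry m c)) A =
    ennreal (measure_pmf.prob (geometric_pmf (1 - 1 / m)) {g. 2 ^ c + 2 + g \<in> A} / m +
    (1 - 1 / m) * indicator A 2)"
    using assms unfolding expiry_def emeasure_bind_pmf
    by (simp add: measure_pmf.emeasure_eq_measure vimage_def ennreal_mult[symmetric]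
        ennreal_plus[symmetric] indicator_def mult.commute del: ennreal_plus)
  then show ?thesis
    using assms by (simp add: measure_pmf.emeasure_eq_measure del: ennreal_plus)
qed

lemma geometric_pmf_nonzero:
  assumes "0 < p" "p \<le> 1"
  shows "measure_pmf.prob (geometric_pmf p) {0<..} = 1 - p"
proof -
  have "measure_pmf.prob (geometric_pmf p) (UNIV - {0}) = 1 - p"
    using measure_pmf.prob_compl[of "{0}" "geometric_pmf p"] assms
    by (simp add: measure_pmf_single)
  moreover have "UNIV - {0} = {0::nat<..}"
    by auto
  ultimately show ?thesis by simp
qed

text \<open>The surviving branch starts at \<open>2 ^ c + 2\<close>, which is at least 3, so only
  the atom at 2 counts.\<close>

lemma prob_expiry_le_2:
  assumes "m \<ge> 2"
  shows "measure_pmf.prob (expiry m c) {..2} = 1 - 1 / m"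
  using assms by (simp add: prob_expiry)

text \<open>One factor \<open>1 / m\<close> is the surviving branch, the other a nonzero geometric
  variable. Summed over the \<open>m * m\<close> options this gives expectation 1, a bounded
  error.\<close>

lemma prob_expiry_late:
  assumes "m \<ge> 2"
  shows "measure_pmf.prob (expiry m c) {2 ^ c + 2<..} = 1 / (m * m)"
  using assms geometric_pmf_nonzero[of "1 - 1 / m"]
  by (simp add: prob_expiry greaterThan_def)

lemma surv_gap_instance:
  assumes "m \<ge> 2"
  shows "surv (gap_instance m) j t =
    measure_pmf.prob (geometric_pmf (1 - 1 / m)) {g. t < 2 ^ opt_class m j + 2 + g} / m +
    (1 - 1 / m) * (if t < 2 then 1 else 0)"
  using assms by (simp add: surv_def prob_expiry)

lemma surv_gap_instance_early:
  assumes "m \<ge> 2" "2 \<le> t" "t \<le> 2 ^ opt_class m j + 1"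
  shows "surv (gap_instance m) j t = 1 / m"
proof -
  have "{g. t < 2 ^ opt_class m j + 2 + g} = UNIV"
    using assms by auto
  then show ?thesis
    using assms by (simp add: surv_gap_instance)
qed

lemma valid_gap_instance:
  assumes "m \<ge> 2"
  shows "valid_instance (gap_instance m)"
proof -
  let ?I = "gap_instance m"
  have "Fbar ?I j (2 ^ m) = 0" if "j \<in> options ?I" for j
    using opt_class_less[OF that] by (simp add: Fbar_gap_instance)
  moreover have "surv ?I j t > 0" for j t
  proof -
    \<comment> \<open>The geometric law has full support because its parameter lies strictly between
      0 and 1; the value \<open>t\<close> is a point of the event.\<close>
    have "measure_pmf.prob (geometric_pmf (1 - 1 / m)) {g. t < 2 ^ opt_class m j + 2 + g} > 0"
      using assms by (intro measure_pmf_posI[of t]) (auto simp: set_pmf_geometric)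
    then show ?thesis
      using assms by (auto simp: surv_gap_instance intro!: add_pos_nonneg divide_pos_pos)
  qed
  moreover have "surv ?I j 1 = 1" for j
  proof -
    have "{g. 1 < 2 ^ opt_class m j + 2 + (g::nat)} = UNIV"
      by auto
    then show ?thesis
      using assms by (simp add: surv_gap_instance)
  qed
  moreover have "set_pmf (expiry m c) \<subseteq> {1..}" for c
    by (auto simp: expiry_def split: if_splits)
  ultimately show ?thesis
    using assms unfolding valid_instance_def by auto
qed

section \<open>Lower bound on the linear program\<close>

text \<open>\<open>lp_value\<close> is a real supremum, so a feasible point bounds it from below
  only once boundedness is known. The first constraint caps each variable by a survival
  probability.\<close>

lemma bdd_above_lp_objective:
  assumes "valid_instance I"
  shows "bdd_above (lp_objective I ` {x. lp_feasible I x})"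
proof (rule bdd_aboveI2)
  fix x assume "x \<in> {x. lp_feasible I x}"
  then have feas: "lp_feasible I x" by simp
  let ?N = "num_opts I * time_bound I"
  show "lp_objective I x \<le> (\<Sum>t\<in>{1..?N}. \<Sum>j\<in>options I. val I j * 1)"
    unfolding lp_objective_def
  proof (intro sum_mono mult_left_mono)
    fix t j assume t: "t \<in> {1..?N}" and j: "j \<in> options I"
    have surv: "surv I j u > 0" "x j u \<ge> 0" if "u \<in> {1..?N}" for u
      using assms feas j that unfolding valid_instance_def lp_feasible_def Let_def by auto
    have "x j t / surv I j t \<le> (\<Sum>u\<in>{1..?N}. x j u / surv I j u)"
      using t surv by (intro member_le_sum) (auto intro!: divide_nonneg_pos)
    also have "\<dots> \<le> 1"
      using feas j unfolding lp_feasible_def Let_def by auto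
    finally have "x j t \<le> surv I j t"
      using surv[OF t] by (simp add: field_simps)
    also have "\<dots> \<le> 1"
      by (simp add: surv_def)
    finally show "x j t \<le> 1" .
    show "0 \<le> val I j"
      using assms j unfolding valid_instance_def by (auto intro: less_imp_le)
  qed
qed

lemma gap_start_le_horizon:
  assumes "m \<ge> 2" "j \<in> options (gap_instance m)"
  shows "2 ^ opt_class m j + 1 \<le> m * m * 2 ^ m"
proof -
  have "(2::nat) ^ opt_class m j \<le> 2 ^ m"
    using opt_class_less[OF assms(2)] by (intro power_increasing) auto
  moreover have "(1::nat) \<le> 2 ^ m"
    by simp
  ultimately have "(2::nat) ^ opt_class m j + 1 \<le> 2 * 2 ^ m"
    by linarith
  also have "\<dots> \<le> m * m * 2 ^ m"
    using mult_le_mono[of 2 m 1 m] assms(1) by (intro mult_le_mono1) linarith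
  finally show ?thesis .
qed

lemma le_lp_value_gap_instance:
  assumes m: "m \<ge> 2"
  shows "real m \<le> lp_value (gap_instance m)"
proof -
  let ?I = "gap_instance m"
  let ?N = "m * m * 2 ^ m"
  \<comment> \<open>Every class \<open>c\<close> option gets all its mass at
    \<open>2 ^ c + 1\<close>, the last time at which it surely remains on the surviving branch. The
    mass equals its survival probability there, so its first constraint is tight.\<close>
  define x :: "nat \<Rightarrow> nat \<Rightarrow> real"
    where "x j t = (if t = 2 ^ opt_class m j + 1 then 1 / m else 0)" for j t
  have start: "2 ^ opt_class m j + 1 \<in> {1..?N}" if "j \<in> options ?I" for j
    using gap_start_le_horizon[OF m that] by simp
  have "(\<Sum>t\<in>{1..?N}. x j t / surv ?I j t) \<le> 1" if j: "j \<in> options ?I" for j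
  proof -
    have "(\<Sum>t\<in>{1..?N}. x j t / surv ?I j t) =
        (\<Sum>t\<in>{1..?N}. if t = 2 ^ opt_class m j + 1 then 1 / m / surv ?I j t else 0)"
      by (intro sum.cong) (auto simp: x_def)
    also have "\<dots> = 1 / m / surv ?I j (2 ^ opt_class m j + 1)"
      using start[OF j] by (subst sum.delta) auto
    also have "\<dots> = 1"
      using m by (subst surv_gap_instance_early) auto
    finally show ?thesis by simp
  qed
  moreover have "(\<Sum>\<tau>\<in>{1..t}. \<Sum>j\<in>options ?I. Fbar ?I j (t - \<tau>) * x j \<tau>) \<le> 1" for t
  proof -
    \<comment> \<open>\<open>D\<close> collects the options whose planned evaluation covers time
      \<open>t\<close>. The intervals of different classes are disjoint, so \<open>D\<close> lies
      within one class: at most \<open>m\<close> options of load \<open>1 / m\<close> each.\<close>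
    define D where "D = {j \<in> options ?I. 2 ^ opt_class m j < t \<and> t \<le> 2 ^ (opt_class m j + 1)}"
    have "(\<Sum>\<tau>\<in>{1..t}. \<Sum>j\<in>options ?I. Fbar ?I j (t - \<tau>) * x j \<tau>) =
        (\<Sum>j\<in>options ?I. \<Sum>\<tau>\<in>{1..t}. if \<tau> = 2 ^ opt_class m j + 1
           then Fbar ?I j (t - \<tau>) / m else 0)"
      by (subst sum.swap, intro sum.cong) (auto simp: x_def)
    also have "\<dots> = (\<Sum>j\<in>options ?I. if j \<in> D then 1 / m else 0)"
      by (intro sum.cong refl, subst sum.delta) (auto simp: D_def Fbar_gap_instance)
    also have "\<dots> = card D / m"
      using finite_option_set[of ?I] by (simp add: sum.If_cases D_def Int_def)
    also have "card D \<le> m"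
    proof (cases "D = {}")
      case False
      then obtain i where i: "i \<in> D" by blast
      have "opt_class m j = opt_class m i" if j: "j \<in> D" for j
      proof -
        have "a \<le> b" if "2 ^ a < t" "t \<le> 2 ^ (b + 1)" for a b
          using that power_less_imp_less_exp[of "2::nat" a "b + 1"] by linarith
        from this[of "opt_class m j" "opt_class m i"] this[of "opt_class m i" "opt_class m j"]
        show ?thesis
          using i j unfolding D_def by auto
      qed
      then have "D \<subseteq> {j \<in> options ?I. opt_class m j = opt_class m i}"
        unfolding D_def by blast
      also have "\<dots> = {opt_class m i * m + 1..<opt_class m i * m + 1 + m}"
        using i by (intro opt_class_fiber opt_class_less) (auto simp: D_def)
      finally have "card D \<le> card {opt_class m i * m + 1..<opt_class m i * m + 1 + m}"
        by (rule card_mono[rotated]) simp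
      then show ?thesis by simp
    qed simp
    then have "card D / m \<le> 1"
      using m by simp
    finally show ?thesis .
  qed
  ultimately have feas: "lp_feasible ?I x"
    unfolding lp_feasible_def Let_def by (auto simp: x_def)
  have "lp_objective ?I x = (\<Sum>j\<in>options ?I. \<Sum>t\<in>{1..?N}. x j t)"
    unfolding lp_objective_def by (subst sum.swap) simp
  also have "\<dots> = (\<Sum>j\<in>options ?I. 1 / m)"
    unfolding x_def using start by (intro sum.cong refl, subst sum.delta) auto
  also have "\<dots> = m"
    using m by (simp add: options_def)
  finally have "real m = lp_objective ?I x" ..
  also have "\<dots> \<le> lp_value ?I"
    unfolding lp_value_def using feas
    by (intro cSUP_upper bdd_above_lp_objective valid_gap_instance m) simp
  finally show ?thesis .
qed

section \<open>Upper bound on every policy\<close>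

text \<open>A pathwise bound whose right-hand side depends neither on the policy nor on
  \<open>s\<close>, so its expectation can be computed from the expirations alone.\<close>

lemma card_selected_gap_instance:
  assumes s: "\<And>j. j \<in> options (gap_instance m) \<Longrightarrow> s j = 2 ^ opt_class m j"
  shows "card (selected (gap_instance m) pol s e) \<le>
    1 + card {j \<in> options (gap_instance m). 2 ^ opt_class m j + 2 < e j} +
    card {c \<in> {..<m}. \<exists>j\<in>options (gap_instance m). opt_class m j = c \<and> 2 < e j}"
proof -
  let ?I = "gap_instance m"
  define H where "H = selections ?I pol s e"
  \<comment> \<open>\<open>A\<close> holds the selection at time 1, \<open>C\<close> those from time
    2 to \<open>2 ^ c + 1\<close>. Any later selection requires expiration after
    \<open>2 ^ c + 2\<close> and so falls into \<open>B\<close>.\<close>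
  define A where "A = {j. (j, 1) \<in> H}"
  define B where "B = {j \<in> options ?I. 2 ^ opt_class m j + 2 < e j}"
  define C where "C = {j. \<exists>u. (j, u) \<in> H \<and> 2 \<le> u \<and> u \<le> 2 ^ opt_class m j + 1}"
  define K where "K = {c \<in> {..<m}. \<exists>j\<in>options ?I. opt_class m j = c \<and> 2 < e j}"
  have H: "j \<in> options ?I" "1 \<le> u" "u < e j" if "(j, u) \<in> H" for j u
    using selections_selection that unfolding H_def by blast+
  have fin: "finite A" "finite B" "finite C"
    using H(1) by (auto intro: finite_subset[OF _ finite_option_set[of ?I]] simp: A_def B_def C_def)
  have "selected ?I pol s e \<subseteq> A \<union> B \<union> C"
  proof
    fix j assume "j \<in> selected ?I pol s e"
    then obtain u where u: "(j, u) \<in> H"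
      unfolding selected_eq_image H_def by auto
    show "j \<in> A \<union> B \<union> C"
    proof (rule ccontr)
      assume "j \<notin> A \<union> B \<union> C"
      with u H[OF u] have "u \<noteq> 1" "e j \<le> 2 ^ opt_class m j + 2"
          "\<not> (2 \<le> u \<and> u \<le> 2 ^ opt_class m j + 1)"
        unfolding A_def B_def C_def by auto
      with H[OF u] show False by linarith
    qed
  qed
  then have "card (selected ?I pol s e) \<le> card (A \<union> B \<union> C)"
    using fin by (intro card_mono) auto
  also have "\<dots> \<le> card A + card B + card C"
    using card_Un_le[of "A \<union> B" C] card_Un_le[of A B] by linarith
  also have "card A \<le> 1"
    using selections_nonoverlapping(2)[of _ 1 ?I pol s e _ 1] fin(1)
    by (auto simp: card_le_Suc0_iff_eq A_def H_def)
  also have "card C = card (opt_class m ` C)"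
  proof (intro card_image[symmetric] inj_onI)
    fix i j assume "i \<in> C" "j \<in> C" and eq: "opt_class m i = opt_class m j"
    then obtain u v where u: "(i, u) \<in> H" "2 \<le> u" "u \<le> 2 ^ opt_class m i + 1"
      and v: "(j, v) \<in> H" "2 \<le> v" "v \<le> 2 ^ opt_class m j + 1"
      unfolding C_def by auto
    \<comment> \<open>With common class \<open>c\<close>, non-overlap would give
      \<open>u + 2 ^ c \<le> v \<le> 2 ^ c + 1\<close>, against \<open>u \<ge> 2\<close>. This is
      why time 1 is counted separately.\<close>
    have "\<not> u < v"
      using selections_nonoverlapping(1)[of i u ?I pol s e j v] u v eq s[OF H(1)[OF u(1)]]
      unfolding H_def by auto
    moreover have "\<not> v < u"
      using selections_nonoverlapping(1)[of j v ?I pol s e i u] u v eq s[OF H(1)[OF v(1)]]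
      unfolding H_def by auto
    ultimately show "i = j"
      using selections_nonoverlapping(2)[of i u ?I pol s e j v] u v unfolding H_def by auto
  qed
  also have "card (opt_class m ` C) \<le> card K"
  proof (intro card_mono subsetI)
    fix c assume "c \<in> opt_class m ` C"
    then obtain j u where "c = opt_class m j" "(j, u) \<in> H" "2 \<le> u"
      unfolding C_def by auto
    then show "c \<in> K"
      using H[of j u] opt_class_less[of j m] unfolding K_def by auto
  qed (simp add: K_def)
  finally show ?thesis
    unfolding B_def K_def by simp
qed

lemma prob_Pi_pmf_component:
  assumes "finite A" "x \<in> A"
  shows "measure_pmf.prob (Pi_pmf A dflt p) {f. f x \<in> B} = measure_pmf.prob (p x) B"
proof -
  have "measure_pmf.prob (Pi_pmf A dflt p) {f. f x \<in> B} =
      measure_pmf.prob (map_pmf (\<lambda>f. f x) (Pi_pmf A dflt p)) B"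
    by (simp add: vimage_def)
  then show ?thesis
    using assms by (simp add: Pi_pmf_component)
qed

text \<open>The complement is a product event, with coordinates outside \<open>C\<close>
  unconstrained, so independence turns its probability into a product.\<close>

lemma prob_Pi_pmf_Bex:
  assumes "finite A" "C \<subseteq> A"
  shows "measure_pmf.prob (Pi_pmf A dflt p) {f. \<exists>x\<in>C. f x \<notin> B} =
    1 - (\<Prod>x\<in>C. measure_pmf.prob (p x) B)"
proof -
  have "measure_pmf.prob (Pi_pmf A dflt p) (Pi A (\<lambda>x. if x \<in> C then B else UNIV)) =
      (\<Prod>x\<in>A. if x \<in> C then measure_pmf.prob (p x) B else 1)"
    using assms(1) by (subst measure_Pi_pmf_Pi) (auto intro!: prod.cong)
  also have "\<dots> = (\<Prod>x\<in>C. measure_pmf.prob (p x) B)"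
    using assms by (simp add: prod.inter_restrict[symmetric] Int_absorb1)
  also have "Pi A (\<lambda>x. if x \<in> C then B else UNIV) = - {f. \<exists>x\<in>C. f x \<notin> B}"
    using assms(2) by (auto simp: Pi_def)
  finally show ?thesis
    using measure_pmf.prob_compl[of "{f. \<exists>x\<in>C. f x \<notin> B}" "Pi_pmf A dflt p"]
    by (simp add: Compl_eq_Diff_UNIV)
qed

lemma policy_value_gap_instance:
  assumes m: "m \<ge> 2"
  shows "policy_value (gap_instance m) pol \<le> 2 + m * (1 - (1 - 1 / m) ^ m)"
proof -
  let ?I = "gap_instance m"
  let ?O = "options ?I"
  define P where "P = Pi_pmf ?O 0 (expi_dist ?I)"
  define late where "late j = {e :: nat \<Rightarrow> nat. 2 ^ opt_class m j + 2 < e j}" for j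
  define alive where "alive c = {e :: nat \<Rightarrow> nat. \<exists>j\<in>?O. opt_class m j = c \<and> 2 < e j}" for c
  \<comment> \<open>The pathwise bound written as a sum of indicators, ready for linearity of
    expectation.\<close>
  define g :: "(nat \<Rightarrow> nat) \<Rightarrow> real"
    where "g e = 1 + (\<Sum>j\<in>?O. indicator (late j) e) + (\<Sum>c<m. indicator (alive c) e)" for e
  have card_le: "real (card (selected ?I pol s e)) \<le> g e"
    if "\<And>j. j \<in> ?O \<Longrightarrow> s j = 2 ^ opt_class m j" for s e
  proof -
    have "(\<Sum>j\<in>?O. indicator (late j) e) = real (card {j \<in> ?O. e \<in> late j})"
      using finite_option_set[of ?I] by (simp add: indicator_def sum.If_cases Int_def)
    moreover have "(\<Sum>c<m. indicator (alive c) e) = real (card {c \<in> {..<m}. e \<in> alive c})"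
      by (simp add: indicator_def sum.If_cases Int_def)
    ultimately show ?thesis
      using card_selected_gap_instance[of m s pol e] that
      unfolding g_def late_def alive_def by simp
  qed
  have "policy_value ?I pol \<le> measure_pmf.expectation (scenarios ?I) (\<lambda>x. g (snd x))"
    unfolding policy_value_def
  proof (rule integral_mono_AE)
    show "integrable (measure_pmf (scenarios ?I)) (\<lambda>(s, e). \<Sum>j\<in>selected ?I pol s e. val ?I j)"
      using card_mono[OF finite_option_set selected_subset[of ?I pol]]
      by (intro measure_pmf.integrable_const_bound[where B = "card ?O"]) auto
    have "g e \<le> 1 + card ?O + m" "0 \<le> g e" for e
      using sum_mono[of ?O "\<lambda>j. indicator (late j) e" "\<lambda>_. 1::real"]
        sum_mono[of "{..<m}" "\<lambda>c. indicator (alive c) e" "\<lambda>_. 1::real"]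
      by (auto simp: g_def indicator_def intro!: add_nonneg_nonneg sum_nonneg)
    then show "integrable (measure_pmf (scenarios ?I)) (\<lambda>x. g (snd x))"
      by (intro measure_pmf.integrable_const_bound[where B = "1 + card ?O + m"]) auto
    \<comment> \<open>The pathwise bound presupposes the prescribed evaluation times; they hold on
      the support of \<open>scenarios\<close>, hence almost surely.\<close>
    show "AE x in measure_pmf (scenarios ?I).
        (case x of (s, e) \<Rightarrow> \<Sum>j\<in>selected ?I pol s e. val ?I j) \<le> g (snd x)"
      using finite_option_set[of ?I] card_le
      by (auto simp: AE_measure_pmf_iff scenarios_def set_Pi_pmf PiE_dflt_def)
  qed
  also have "\<dots> = measure_pmf.expectation P g"
    unfolding scenarios_def P_def by simp
  also have "\<dots> = 1 + (\<Sum>j\<in>?O. measure_pmf.prob P (late j)) + (\<Sum>c<m. measure_pmf.prob P (alive c))"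
  proof -
    have "integrable (measure_pmf P) (indicator A :: _ \<Rightarrow> real)" for A
      by (intro measure_pmf.integrable_const_bound[where B = 1]) auto
    then show ?thesis
      unfolding g_def
      by (subst Bochner_Integration.integral_add; (subst Bochner_Integration.integral_add)?) auto
  qed
  also have "(\<Sum>j\<in>?O. measure_pmf.prob P (late j)) = (\<Sum>j\<in>?O. 1 / (m * m))"
  proof (intro sum.cong refl)
    fix j assume j: "j \<in> ?O"
    show "measure_pmf.prob P (late j) = 1 / (m * m)"
      using prob_Pi_pmf_component[OF finite_option_set j, of 0 "expi_dist ?I" "{2 ^ opt_class m j + 2<..}"]
        prob_expiry_late[OF m] by (simp add: P_def late_def)
  qed
  also have "\<dots> = 1"
    using m by (simp add: options_def)
  also have "(\<Sum>c<m. measure_pmf.prob P (alive c)) = (\<Sum>c<m. 1 - (1 - 1 / m) ^ m)"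
  proof (intro sum.cong refl)
    fix c assume "c \<in> {..<m}"
    then have card: "card {j \<in> ?O. opt_class m j = c} = m"
      by (subst opt_class_fiber) auto
    have "alive c = {e. \<exists>j\<in>{j \<in> ?O. opt_class m j = c}. e j \<notin> {..2}}"
      by (auto simp: alive_def)
    \<comment> \<open>The class has no survivor iff all its \<open>m\<close> independent expirations
      are at most 2, each with probability \<open>1 - 1 / m\<close>.\<close>
    then show "measure_pmf.prob P (alive c) = 1 - (1 - 1 / m) ^ m"
      using prob_Pi_pmf_Bex[of ?O "{j \<in> ?O. opt_class m j = c}" 0 "expi_dist ?I" "{..2}"]
        finite_option_set[of ?I] prob_expiry_le_2[OF m] card
      by (simp add: P_def)
  qed
  finally show ?thesis by simp
qed

section \<open>The ratio and its limit\<close>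

lemma opt_lp_ratio_gap_instance:
  assumes m: "m \<ge> 2"
  shows "opt_value (gap_instance m) / lp_value (gap_instance m) \<le> 2 / m + (1 - (1 - 1 / m) ^ m)"
proof -
  let ?I = "gap_instance m"
  let ?B = "2 + m * (1 - (1 - 1 / m) ^ m)"
  have "opt_value ?I \<le> ?B"
    unfolding opt_value_def by (intro cSUP_least policy_value_gap_instance m) simp
  \<comment> \<open>Enlarging the numerator to \<open>?B\<close> and shrinking the denominator to
    \<open>m\<close> is monotone only for a nonnegative numerator bound.\<close>
  moreover have "0 \<le> ?B"
    using m by (intro add_nonneg_nonneg mult_nonneg_nonneg) (auto simp: power_le_one)
  moreover have "m \<le> lp_value ?I"
    by (rule le_lp_value_gap_instance[OF m])
  ultimately have "opt_value ?I / lp_value ?I \<le> ?B / m"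
    using m by (intro frac_le) auto
  also have "\<dots> = 2 / m + (1 - (1 - 1 / m) ^ m)"
    using m by (simp add: add_divide_distrib)
  finally show ?thesis .
qed

theorem lemma3p7:
  shows "\<exists>I :: nat \<Rightarrow> sse_instance.
           (\<forall>k. valid_instance (I k)) \<and>
           filterlim (\<lambda>k. num_opts (I k)) at_top sequentially \<and>
           limsup (\<lambda>k. ereal (opt_value (I k) / lp_value (I k))) \<le> ereal (1 - 1 / exp 1)"
proof (intro exI conjI allI)
  \<comment> \<open>The shift by 2 makes every index meet the hypothesis
    \<open>m \<ge> 2\<close>.\<close>
  let ?I = "\<lambda>k. gap_instance (k + 2)"
  show "valid_instance (?I k)" for k
    by (rule valid_gap_instance) simp
  show "filterlim (\<lambda>k. num_opts (?I k)) at_top sequentially"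
    by (rule filterlim_at_top_mono[OF filterlim_ident]) auto
  let ?r = "\<lambda>m. 2 / real m + (1 - (1 - 1 / real m) ^ m)"
  \<comment> \<open>Writing \<open>1 - 1 / m\<close> as \<open>1 + (- 1) / m\<close> exhibits the
    power as the standard sequence converging to \<open>exp (- 1)\<close>.\<close>
  have "(\<lambda>m. 2 / real m + (1 - (1 + (- 1) / real m) ^ m)) \<longlonglongrightarrow> 0 + (1 - exp (- 1))"
    by (intro tendsto_intros lim_const_over_n tendsto_exp_limit_sequentially)
  then have "?r \<longlonglongrightarrow> 1 - 1 / exp 1"
    by (simp add: exp_minus inverse_eq_divide)
  then have "(\<lambda>k. ereal (?r (k + 2))) \<longlonglongrightarrow> ereal (1 - 1 / exp 1)"
    by (intro tendsto_ereal LIMSEQ_ignore_initial_segment)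
  then have "limsup (\<lambda>k. ereal (?r (k + 2))) = ereal (1 - 1 / exp 1)"
    by (intro lim_imp_Limsup) auto
  moreover have "limsup (\<lambda>k. ereal (opt_value (?I k) / lp_value (?I k))) \<le>
      limsup (\<lambda>k. ereal (?r (k + 2)))"
    by (intro Limsup_mono always_eventually allI, unfold ereal_less_eq) (rule opt_lp_ratio_gap_instance, simp)
  ultimately show "limsup (\<lambda>k. ereal (opt_value (?I k) / lp_value (?I k))) \<le> ereal (1 - 1 / exp 1)"
    by simp
qed

end
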